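(* Let $q \geq 1$ be an integer and let $\chi$ be a non-principal Dirichlet character modulo $q$. Then $$|L(1+it,\chi)| < \frac{\varphi(q)}{q}\log t + \log q + \gamma$$ for all real $t > 50$.
   Context: $L(s,\chi)=\sum_{n\ge 1}\chi(n)n^{-s}$ is the Dirichlet $L$-function of $\chi$, defined by this series for $\mathrm{Re}(s)>1$ and by analytic continuation elsewhere (for non-principal $\chi$ the series also converges for $\mathrm{Re}(s)>0$). $\varphi$ is Euler's totient function and $\gamma$ is the Euler–Mascheroni constant. *)

theory Defs
  imports "HOL-Complex_Analysis.Complex_Analysis" "HOL-Number_Theory.Number_Theory"
begin

(* chi 1 = 1 follows from multiplicativity together with chi 1 \<noteq> 0. *)
definition dirichlet_character :: "nat \<Rightarrow> (int \<Rightarrow> complex) \<Rightarrow> bool" where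
  "dirichlet_character q chi \<longleftrightarrow>
     q > 0 \<and>
     (\<forall>m n. chi (m * n) = chi m * chi n) \<and>
     (\<forall>n. chi (n + int q) = chi n) \<and>
     (\<forall>n. chi n \<noteq> 0 \<longleftrightarrow> coprime n (int q))"

definition principal_character :: "nat \<Rightarrow> int \<Rightarrow> complex" where
  "principal_character q n = (if coprime n (int q) then 1 else 0)"

(* The value at s of the analytic continuation of the Dirichlet series to a half-plane
   Re z > c containing s. The exceptional set P accommodates the pole at 1 that occurs for
   principal characters; for these, the value at s = 1 is unspecified.
   The value does not depend on c, f and P: the domains of any two such functions meet in
   a connected open set containing Re z > 1, where both are given by the series. *)
definition dirichlet_L :: "complex \<Rightarrow> (int \<Rightarrow> complex) \<Rightarrow> complex" where
  "dirichlet_L s chi =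
     (THE w. \<exists>c f P. c \<le> 1 \<and> c < Re s \<and> P \<subseteq> {1} \<and> s \<notin> P \<and>
        f holomorphic_on ({z. Re z > c} - P) \<and>
        (\<forall>z. Re z > 1 \<longrightarrow>
           (\<lambda>n. chi (int (Suc n)) * of_nat (Suc n) powr (- z)) sums f z) \<and>
        w = f s)"

end

theory Submission
  imports Defs
begin

text \<open>
  Splitting into residue classes gives
  \<open>L(s, chi) = (\<Sum>a = 1..q. chi a * (a powr - s + q powr - s * zeta (s, 1 + a / q)))\<close>
  with the Hurwitz zeta function. For \<open>b \<ge> 1\<close> and \<open>t > 50\<close> one has \<open>\<bar>zeta (1 + i t, b)\<bar> < ln t\<close>:
  keep the first \<open>N \<approx> t / 4\<close> terms, which contribute at most \<open>harm N\<close>, and compare the rest with an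
  integral by the midpoint rule, whose total error is at most about \<open>t^2 / (48 * N^2)\<close>.
  So \<open>\<bar>L(1 + i t, chi)\<bar>\<close> is at most the sum of \<open>1 / a + ln t / q\<close> over the \<open>a < q\<close> coprime to q, and
  \<open>harm (q - 1) < ln q + gamma\<close>.
\<close>

section \<open>Error of the midpoint rule for complex powers\<close>

text \<open>
  The error of the midpoint rule for \<open>x powr - z\<close> on \<open>[y - 1/2, y + 1/2]\<close>.
  The junk value of the division makes it meaningless for \<open>z = 1\<close>.
\<close>

definition mid_err :: "complex \<Rightarrow> real \<Rightarrow> complex" where
  "mid_err z y = of_real y powr - z
     - (of_real (y + 1/2) powr (1 - z) - of_real (y - 1/2) powr (1 - z)) / (1 - z)"

lemma norm_of_real_powr: "x > 0 \<Longrightarrow> cmod (of_real x powr z) = x powr Re z"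
  by (simp add: norm_powr_real_powr)

text \<open>The positive base keeps the power off its branch cut. The slopes used are
  \<open>c = 1\<close> and \<open>c = -1\<close>, for the two ends of an interval growing about its
  midpoint.\<close>

lemma has_vector_derivative_real_powr:
  fixes a c :: real and w :: complex
  assumes "a + c * x > 0"
  shows "((\<lambda>x. of_real (a + c * x) powr w) has_vector_derivative
           of_real c * w * of_real (a + c * x) powr (w - 1)) (at x)"
proof -
  have "complex_of_real a + of_real c * of_real x = of_real (a + c * x)"
    by simp
  also have "\<dots> \<notin> \<real>\<^sub>\<le>\<^sub>0"
    using assms by (subst complex_nonpos_Reals_iff) simp
  finally have nonpos: "complex_of_real a + of_real c * of_real x \<notin> \<real>\<^sub>\<le>\<^sub>0" .
  show ?thesis
    unfolding of_real_add of_real_mult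
    by (rule has_vector_derivative_real_field[where f = "\<lambda>u. (of_real a + of_real c * u) powr w"])
       (use nonpos in \<open>auto intro!: derivative_eq_intros\<close>)
qed

text \<open>As a function of the half-width, the error vanishes to third order at 0, so Taylor at
  \<open>1/2\<close> leaves the third derivative over \<open>6 * 2^3 = 48\<close>. That derivative
  contains two endpoint powers, each at most the power at the left end; hence
  \<open>2 / 48 = 1 / 24\<close>.\<close>

lemma norm_mid_err_le:
  assumes "y > 1/2" "Re z \<ge> 0" "z \<noteq> 1"
  shows "cmod (mid_err z y) \<le> cmod z * cmod (z + 1) / 24 * (y - 1/2) powr (- Re z - 2)"
proof -
  define P where "P = (\<lambda>w h. of_real (y + 1 * h) powr w :: complex)"
  define Q where "Q = (\<lambda>w h. of_real (y + (-1) * h) powr w :: complex)"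
  \<comment> \<open>\<open>D 0 h\<close> is the integral minus the midpoint value on \<open>[y - h, y + h]\<close> and \<open>D m\<close> its m-th derivative; the
    factor v makes \<open>D 0 (1/2)\<close> a nonnegative real, so that the real Taylor theorem applies.\<close>
  define D :: "nat \<Rightarrow> real \<Rightarrow> complex" where
    "D = (\<lambda>m h. if m = 0 then (P (1 - z) h - Q (1 - z) h) / (1 - z) - 2 * of_real h * of_real y powr (- z)
           else if m = 1 then P (- z) h + Q (- z) h - 2 * of_real y powr (- z)
           else if m = 2 then - z * (P (- z - 1) h - Q (- z - 1) h)
           else z * (z + 1) * (P (- z - 2) h + Q (- z - 2) h))"
  define v where "v = cnj (sgn (D 0 (1/2)))"
  have dP: "(P w has_vector_derivative w * P (w - 1) h) (at h)" if "0 \<le> h" "h \<le> 1/2" for w h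
    using has_vector_derivative_real_powr[of y 1 h w] that assms unfolding P_def by simp
  have dQ: "(Q w has_vector_derivative - w * Q (w - 1) h) (at h)" if "0 \<le> h" "h \<le> 1/2" for w h
    using has_vector_derivative_real_powr[of y "-1" h w] that assms unfolding Q_def by simp
  have z1: "1 - z \<noteq> 0"
    using assms by simp
  have dD: "(D m has_vector_derivative D (Suc m) h) (at h)" if m: "m < 3" and "0 \<le> h" "h \<le> 1/2" for m h
  proof -
    consider "m = 0" | "m = 1" | "m = 2" using m by linarith
    then show ?thesis
    proof cases
      case 1
      show ?thesis unfolding 1 D_def using z1
        by (auto intro!: derivative_eq_intros dP dQ that simp: field_simps)
    next
      case 2
      show ?thesis unfolding 2 D_def
        by (auto intro!: derivative_eq_intros dP dQ that simp: field_simps)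
    next
      case 3
      have "- z - 1 - 1 = - z - 2" by simp
      then show ?thesis unfolding 3 D_def
        by (auto intro!: derivative_eq_intros dP[of _ "- z - 1"] dQ[of _ "- z - 1"] that simp: algebra_simps)
    qed
  qed
  have "\<exists>t. 0 < t \<and> t < 1/2 \<and> Re (v * D 0 (1/2)) =
        (\<Sum>m<3. Re (v * D m 0) / fact m * (1/2) ^ m) + Re (v * D 3 t) / fact 3 * (1/2) ^ 3"
  proof (rule Maclaurin[where diff = "\<lambda>m h. Re (v * D m h)"]; (intro allI impI)?)
    fix m :: nat and h :: real
    assume mh: "m < 3 \<and> 0 \<le> h \<and> h \<le> 1/2"
    then have "((\<lambda>h. v * D m h) has_vector_derivative v * D (Suc m) h) (at h)"
      by (intro has_vector_derivative_mult_right dD) auto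
    then show "((\<lambda>h. Re (v * D m h)) has_real_derivative Re (v * D (Suc m) h)) (at h)"
      by (rule has_field_derivative_Re)
  qed auto
  then obtain t where t: "0 < t" "t < 1/2" and
    eq: "Re (v * D 0 (1/2)) =
        (\<Sum>m<3. Re (v * D m 0) / fact m * (1/2) ^ m) + Re (v * D 3 t) / fact 3 * (1/2) ^ 3"
    by blast
  have D0: "D m 0 = 0" if m: "m < 3" for m
  proof -
    consider "m = 0" | "m = 1" | "m = 2" using m by linarith
    then show ?thesis by cases (auto simp: D_def P_def Q_def)
  qed
  have Dm: "cmod (D 0 (1/2)) = cmod (mid_err z y)"
  proof -
    have "D 0 (1/2) = - mid_err z y"
      by (simp add: D_def P_def Q_def mid_err_def)
    then show ?thesis by simp
  qed
  have "v * D 0 (1/2) = of_real (cmod (D 0 (1/2)))"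
  proof (cases "D 0 (1/2) = 0")
    case False
    have "v * D 0 (1/2) = D 0 (1/2) * cnj (D 0 (1/2)) / of_real (cmod (D 0 (1/2)))"
      by (simp add: v_def sgn_eq)
    also have "\<dots> = of_real (cmod (D 0 (1/2)))"
      using False by (simp add: power2_eq_square flip: complex_norm_square)
    finally show ?thesis .
  qed simp
  then have "cmod (mid_err z y) = Re (v * D 3 t) / 48"
    using eq Dm by (simp add: D0 fact_numeral power3_eq_cube)
  also have "\<dots> \<le> cmod (v * D 3 t) / 48"
    by (intro divide_right_mono complex_Re_le_cmod) auto
  \<comment> \<open>\<open>v\<close> has modulus 1, or 0 if \<open>D 0 (1/2) = 0\<close>.\<close>
  also have "\<dots> \<le> cmod (D 3 t) / 48"
    by (simp add: v_def norm_mult norm_sgn)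
  also have "cmod (D 3 t) \<le> cmod z * cmod (z + 1) * (2 * (y - 1/2) powr (- Re z - 2))"
  proof -
    have "cmod (P (- z - 2) t + Q (- z - 2) t) \<le> cmod (P (- z - 2) t) + cmod (Q (- z - 2) t)"
      by (rule norm_triangle_ineq)
    also have "\<dots> = (y + t) powr (- Re z - 2) + (y - t) powr (- Re z - 2)"
      using norm_of_real_powr[of "y + t" "- z - 2"] norm_of_real_powr[of "y - t" "- z - 2"] t assms
      by (simp add: P_def Q_def)
    also have "\<dots> \<le> 2 * (y - 1/2) powr (- Re z - 2)"
    proof -
      have "(y + t) powr (- Re z - 2) \<le> (y - 1/2) powr (- Re z - 2)"
        using t assms by (intro powr_mono2') auto
      moreover have "(y - t) powr (- Re z - 2) \<le> (y - 1/2) powr (- Re z - 2)"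
        using t assms by (intro powr_mono2') auto
      ultimately show ?thesis by simp
    qed
    finally have "cmod (P (- z - 2) t + Q (- z - 2) t) \<le> 2 * (y - 1/2) powr (- Re z - 2)" .
    then show ?thesis
      by (auto simp: D_def norm_mult intro!: mult_left_mono)
  qed
  finally show ?thesis by simp
qed

section \<open>The Hurwitz zeta function and its continuation\<close>

text \<open>
  This is the Hurwitz zeta function in the form that the midpoint rule gives: the integrals
  telescope, and \<open>(b - 1/2) powr (1 - z) / (z - 1)\<close> is the integral from \<open>b - 1/2\<close> to infinity.
  Its pole at 1 stays in \<open>dirichlet_L_eq_sum_hurwitz\<close>: instead of cancelling the poles over the
  residue classes, we use that \<open>dirichlet_L\<close> admits the exceptional set \<open>{1}\<close>.
\<close>

definition hurwitz :: "real \<Rightarrow> complex \<Rightarrow> complex" where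
  "hurwitz b z = (\<Sum>n. mid_err z (real n + b)) + of_real (b - 1/2) powr (1 - z) / (z - 1)"

text \<open>Weakening the exponent to -2 leaves \<open>z\<close> only in a locally bounded factor,
  as the M-test requires. The index starts at 1 because the weakening needs a base of at least
  1.\<close>

lemma norm_mid_err_Suc_le:
  assumes "b \<ge> 1" "Re z \<ge> 0" "z \<noteq> 1"
  shows "cmod (mid_err z (real (Suc n) + b)) \<le> cmod z * cmod (z + 1) / 24 * (1 / real (Suc n) ^ 2)"
proof -
  have "(real (Suc n) + b - 1/2) powr (- Re z - 2) \<le> (real (Suc n) + b - 1/2) powr (-2)"
    using assms by (intro powr_mono) auto
  also have "\<dots> \<le> real (Suc n) powr (-2)"
    using assms by (intro powr_mono2') auto
  also have "\<dots> = 1 / real (Suc n) ^ 2"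
    by (simp add: powr_minus powr_numeral divide_inverse)
  finally show ?thesis
    using assms by (intro order_trans[OF norm_mid_err_le] mult_left_mono) auto
qed

lemma summable_mid_err:
  assumes "b \<ge> 1" "Re z \<ge> 0" "z \<noteq> 1"
  shows "summable (\<lambda>n. mid_err z (real n + b))"
proof -
  have "summable (\<lambda>n. cmod z * cmod (z + 1) / 24 * (1 / real (Suc n) ^ 2))"
    using summable_Suc_iff[of "\<lambda>n. 1 / real n ^ 2"]
    by (intro summable_mult) (simp add: inverse_power_summable[of 2] inverse_eq_divide[symmetric])
  then have "summable (\<lambda>n. mid_err z (real (Suc n) + b))"
    by (rule summable_comparison_test'[of _ 0]) (use norm_mid_err_Suc_le[OF assms] in auto)
  then show ?thesis
    using summable_Suc_iff[of "\<lambda>n. mid_err z (real n + b)"] by simp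
qed

text \<open>The integrals in the first \<open>N\<close> errors telescope and move the boundary from
  \<open>b - 1/2\<close> to \<open>N + b - 1/2\<close>. Letting \<open>N\<close> tend to infinity
  recovers the series; a finite \<open>N\<close> gives the estimate on the line
  \<open>Re z = 1\<close>.\<close>

lemma hurwitz_shift:
  assumes "b \<ge> 1" "Re z \<ge> 0" "z \<noteq> 1"
  shows "hurwitz b z = (\<Sum>n<N. of_real (real n + b) powr - z)
           + (\<Sum>n. mid_err z (real (n + N) + b)) + of_real (real N + b - 1/2) powr (1 - z) / (z - 1)"
proof -
  define B where "B = (\<lambda>n. complex_of_real (real n + b - 1/2) powr (1 - z))"
  have "(\<Sum>n<N. mid_err z (real n + b)) =
        (\<Sum>n<N. of_real (real n + b) powr - z - (B (Suc n) - B n) / (1 - z))"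
    by (intro sum.cong) (auto simp: mid_err_def B_def algebra_simps)
  also have "\<dots> = (\<Sum>n<N. of_real (real n + b) powr - z) - (\<Sum>n<N. B (Suc n) - B n) / (1 - z)"
    by (simp only: sum_subtractf[of _ "\<lambda>n. (B (Suc n) - B n) / (1 - z)"] sum_divide_distrib)
  also have "(\<Sum>n<N. B (Suc n) - B n) = B N - B 0"
    by (rule sum_lessThan_telescope)
  also have "(\<Sum>n<N. of_real (real n + b) powr - z) - (B N - B 0) / (1 - z) =
      (\<Sum>n<N. of_real (real n + b) powr - z) + B N / (z - 1) - B 0 / (z - 1)"
    using assms by (simp add: divide_simps) (simp add: algebra_simps)
  finally have head: "(\<Sum>n<N. mid_err z (real n + b)) =
     (\<Sum>n<N. of_real (real n + b) powr - z) + B N / (z - 1) - B 0 / (z - 1)" .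
  have "(\<Sum>n. mid_err z (real n + b)) =
        (\<Sum>n. mid_err z (real (n + N) + b)) + (\<Sum>n<N. mid_err z (real n + b))"
    by (rule suminf_split_initial_segment[OF summable_mid_err[OF assms]])
  then show ?thesis
    unfolding hurwitz_def head by (simp add: B_def)
qed

lemma hurwitz_sums:
  assumes "b \<ge> 1" "Re z > 1"
  shows "(\<lambda>n. of_real (real n + b) powr - z) sums hurwitz b z"
proof -
  have z: "Re z \<ge> 0" "z \<noteq> 1" using assms by auto
  define T where "T = (\<lambda>N. (\<Sum>n. mid_err z (real (n + N) + b)))"
  define B where "B = (\<lambda>N. complex_of_real (real N + b - 1/2) powr (1 - z))"
  have "T \<longlonglongrightarrow> 0"
    unfolding T_def by (rule suminf_exist_split2[OF summable_mid_err[OF assms(1) z]])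
  moreover have "B \<longlonglongrightarrow> 0"
  proof (rule tendsto_norm_zero_cancel)
    have "cmod (B N) = (real N + b - 1/2) powr (1 - Re z)" for N
      unfolding B_def using assms by (subst norm_of_real_powr) auto
    moreover have "(\<lambda>N. (real N + b - 1/2) powr (1 - Re z)) \<longlonglongrightarrow> 0"
      using assms by real_asymp
    ultimately show "(\<lambda>N. cmod (B N)) \<longlonglongrightarrow> 0" by simp
  qed
  ultimately have "(\<lambda>N. hurwitz b z - T N - B N / (z - 1)) \<longlonglongrightarrow> hurwitz b z - 0 - 0 / (z - 1)"
    using z by (intro tendsto_intros) auto
  moreover have "hurwitz b z - T N - B N / (z - 1) = (\<Sum>n<N. of_real (real n + b) powr - z)" for N
    using hurwitz_shift[OF assms(1) z, of N] by (simp add: T_def B_def)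
  ultimately show ?thesis by (simp add: sums_def)
qed

lemma holomorphic_on_mid_err: "(\<lambda>z. mid_err z y) holomorphic_on - {1}"
  unfolding mid_err_def by (intro holomorphic_intros) auto

lemma holomorphic_on_hurwitz:
  assumes "b \<ge> 1"
  shows "hurwitz b holomorphic_on {z. Re z > 0} - {1}"
proof -
  let ?S = "{z. Re z > 0} - {1 :: complex}"
  have "open ?S" by (intro open_Diff open_halfspace_Re_gt) auto
  have "(\<lambda>z. \<Sum>n. mid_err z (real n + b)) holomorphic_on ?S"
  proof (rule holomorphic_uniform_sequence[OF \<open>open ?S\<close>])
    show "(\<lambda>z. \<Sum>n<N. mid_err z (real n + b)) holomorphic_on ?S" for N
      by (intro holomorphic_on_sum holomorphic_on_subset[OF holomorphic_on_mid_err]) auto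
  next
    fix x assume "x \<in> ?S"
    then obtain d where d: "d > 0" "cball x d \<subseteq> ?S"
      using \<open>open ?S\<close> open_contains_cball by blast
    define C where "C = (cmod x + d) * (cmod x + d + 1) / 24"
    have bound: "cmod z * cmod (z + 1) / 24 \<le> C" if "z \<in> cball x d" for z
    proof -
      have "cmod z \<le> cmod x + d"
        using that norm_triangle_ineq2[of z x] by (simp add: dist_norm norm_minus_commute)
      moreover have "cmod (z + 1) \<le> cmod z + 1"
        using norm_triangle_ineq[of z 1] by simp
      ultimately show ?thesis
        unfolding C_def using d by (intro divide_right_mono mult_mono) auto
    qed
    \<comment> \<open>Only eventually in \<open>n\<close>: at \<open>n = 0\<close> the majorant is
      0, since \<open>1 / 0 = 0\<close>.\<close>
    have ev: "\<forall>\<^sub>F n in sequentially. \<forall>z\<in>cball x d. cmod (mid_err z (real n + b)) \<le> C * (1 / real n ^ 2)"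
      using eventually_gt_at_top[of "0::nat"]
    proof eventually_elim
      case (elim n)
      then obtain m where m: "n = Suc m" by (cases n) auto
      show ?case
      proof
        fix z assume z: "z \<in> cball x d"
        then have "Re z \<ge> 0" "z \<noteq> 1" using d by auto
        then have "cmod (mid_err z (real n + b)) \<le> cmod z * cmod (z + 1) / 24 * (1 / real n ^ 2)"
          unfolding m using assms by (intro norm_mid_err_Suc_le)
        also have "\<dots> \<le> C * (1 / real n ^ 2)"
          by (intro mult_right_mono bound z) auto
        finally show "cmod (mid_err z (real n + b)) \<le> C * (1 / real n ^ 2)" .
      qed
    qed
    have "summable (\<lambda>n. C * (1 / real n ^ 2))"
      by (intro summable_mult) (simp add: inverse_power_summable[of 2] inverse_eq_divide[symmetric])
    then show "\<exists>d>0. cball x d \<subseteq> ?S \<and> uniform_limit (cball x d)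
        (\<lambda>N z. \<Sum>n<N. mid_err z (real n + b)) (\<lambda>z. \<Sum>n. mid_err z (real n + b)) sequentially"
      using d Weierstrass_m_test_ev[OF ev] by blast
  qed
  then show ?thesis
    unfolding hurwitz_def by (intro holomorphic_intros) auto
qed

section \<open>Bounding the Hurwitz zeta function on the line \<open>Re z = 1\<close>\<close>

lemma harm_less_ln_add_euler_mascheroni:
  "harm n < ln (real n + 1) + euler_mascheroni"
proof (cases "n = 0")
  case False
  then have "harm n - ln (real (Suc n)) + inverse (real (2 * (n + 1))) \<le> euler_mascheroni"
    using euler_mascheroni_bounds[of n] by auto
  moreover have "inverse (real (2 * (n + 1))) > 0" by simp
  ultimately have "harm n < ln (real (Suc n)) + euler_mascheroni" by linarith
  then show ?thesis by (simp add: add.commute)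
qed (use euler_mascheroni_pos in \<open>simp add: harm_def\<close>)

text \<open>The right-hand side is the integral of the decreasing function \<open>1 / x^3\<close>
  over \<open>[u, u + 1]\<close>. It makes the bound for the midpoint errors telescope.\<close>

lemma inverse_cube_le_telescope:
  fixes u :: real
  assumes "u > 0"
  shows "1 / (u + 1) ^ 3 \<le> (1 / u^2 - 1 / (u + 1)^2) / 2"
proof -
  have "(1 / u^2 - 1 / (u + 1)^2) / 2 - 1 / (u + 1) ^ 3 = (3 * u + 1) / (2 * u^2 * (u + 1) ^ 3)"
    using assms by (simp add: divide_simps) (simp add: algebra_simps eval_nat_numeral)
  also have "\<dots> \<ge> 0"
    using assms by (intro divide_nonneg_nonneg) auto
  finally show ?thesis by simp
qed

lemma norm_hurwitz_one_line_less:
  assumes "b \<ge> 1" "t > 50"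
  shows "cmod (hurwitz b (1 + \<i> * of_real t)) < ln t"
proof -
  define s where "s = 1 + \<i> * of_real t"
  \<comment> \<open>With \<open>N = c * t\<close> the bound is about \<open>ln t + ln c + gamma + 1 / (48 * c^2)\<close>, and \<open>c = 1/4\<close> leaves
    enough room for the rounding of N and the boundary term.\<close>
  define N where "N = nat \<lfloor>t / 4\<rfloor>"
  have N: "real N \<le> t / 4" "real N > t / 4 - 1"
    using assms unfolding N_def by linarith+
  have s: "Re s = 1" "Re s \<ge> 0" "s \<noteq> 1"
    using assms by (auto simp: s_def complex_eq_iff)
  define K where "K = cmod s * cmod (s + 1)"
  have K: "0 \<le> K" "K \<le> t^2 + 5/2"
  proof -
    have "K = sqrt ((1 + t^2) * (4 + t^2))"
      by (simp add: K_def s_def cmod_def real_sqrt_mult)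
    \<comment> \<open>Geometric mean against arithmetic mean of \<open>1 + t^2\<close> and
      \<open>4 + t^2\<close>.\<close>
    also have "\<dots> \<le> t^2 + 5/2"
    proof (rule real_le_lsqrt)
      have "(1 + T) * (4 + T) \<le> (T + 5/2)^2" for T :: real
        by (simp add: power2_eq_square algebra_simps)
      then show "(1 + t^2) * (4 + t^2) \<le> (t^2 + 5/2)^2" .
    qed simp
    finally show "K \<le> t^2 + 5/2" .
  qed (simp add: K_def)
  have "cmod (\<Sum>n<N. of_real (real n + b) powr - s) \<le> (\<Sum>n<N. cmod (of_real (real n + b) powr - s))"
    by (rule norm_sum)
  also have "\<dots> \<le> (\<Sum>n<N. inverse (real (Suc n)))"
  proof (rule sum_mono)
    fix n
    have "cmod (of_real (real n + b) powr - s) = inverse (real n + b)"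
      using assms s by (subst norm_of_real_powr) (auto simp: powr_minus)
    also have "\<dots> \<le> inverse (real (Suc n))"
      using assms by (intro le_imp_inverse_le) auto
    finally show "cmod (of_real (real n + b) powr - s) \<le> inverse (real (Suc n))" .
  qed
  also have "\<dots> = harm N"
    by (simp add: harm_altdef)
  finally have head: "cmod (\<Sum>n<N. of_real (real n + b) powr - s) \<le> harm N" .

  \<comment> \<open>\<open>g n\<close> is \<open>K / 24\<close> times the integral of
    \<open>1 / x^3\<close> from \<open>n + N - 1/2\<close> to infinity; its differences dominate the
    errors, so \<open>g 0\<close> bounds the tail.\<close>
  define g where "g = (\<lambda>n. K / 48 * (1 / (real n + real N - 1/2)^2))"
  have "g \<longlonglongrightarrow> 0"
    unfolding g_def by real_asymp
  from telescope_sums'[OF this] have g: "(\<lambda>n. g n - g (Suc n)) sums g 0"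
    by simp
  have "cmod (mid_err s (real (n + N) + b)) \<le> g n - g (Suc n)" for n
  proof -
    define x where "x = real n + real N"
    have x: "x \<ge> 1" using N assms by (simp add: x_def)
    have "cmod (mid_err s (real (n + N) + b)) \<le> K / 24 * (x + b - 1/2) powr (- 3)"
      using norm_mid_err_le[of "x + b" s] assms s x by (simp add: K_def x_def)
    also have "\<dots> \<le> K / 24 * (x + 1/2) powr (-3)"
      using K x assms by (intro mult_left_mono powr_mono2') auto
    also have "(x + 1/2) powr (-3) = 1 / (x + 1/2) ^ 3"
    proof -
      have "w powr (-3) = 1 / w ^ 3" if "w > 0" for w :: real
        using that by (simp add: powr_minus_divide)
      then show ?thesis using x by simp
    qed
    also have "K / 24 * (1 / (x + 1/2) ^ 3) \<le> K / 24 * ((1 / (x - 1/2)^2 - 1 / (x + 1/2)^2) / 2)"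
      using inverse_cube_le_telescope[of "x - 1/2"] x K by (intro mult_left_mono) (auto simp: add.commute)
    also have "\<dots> = g n - g (Suc n)"
    proof -
      have "real n + real N - 1/2 = x - 1/2" "real (Suc n) + real N - 1/2 = x + 1/2"
        by (simp_all add: x_def)
      then have "g n - g (Suc n) = K / 48 * (1 / (x - 1/2)^2) - K / 48 * (1 / (x + 1/2)^2)"
        unfolding g_def by presburger
      also have "\<dots> = K / 24 * ((1 / (x - 1/2)^2 - 1 / (x + 1/2)^2) / 2)"
        by (simp add: diff_divide_distrib right_diff_distrib)
      finally show ?thesis ..
    qed
    finally show ?thesis .
  qed
  then have "cmod (\<Sum>n. mid_err s (real (n + N) + b)) \<le> (\<Sum>n. g n - g (Suc n))"
    by (rule norm_suminf_le) (rule sums_summable[OF g])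
  also have "\<dots> = g 0"
    using g by (rule sums_unique[symmetric])
  also have "g 0 \<le> 45 / 100"
  proof -
    have "K / 48 \<le> (t^2 + 5/2) / 48" using K by simp
    \<comment> \<open>\<open>N - 1/2 > t/4 - 3/2\<close>, and this exceeds \<open>22/100 * t\<close>
      exactly when \<open>t > 50\<close>.\<close>
    moreover have "1 / (real N - 1/2)^2 \<le> 1 / (22/100 * t)^2"
      using N assms by (intro divide_left_mono power_mono mult_pos_pos zero_less_power) auto
    ultimately have "g 0 \<le> (t^2 + 5/2) / 48 * (1 / (22/100 * t)^2)"
      unfolding g_def using K by (simp only: of_nat_0 add_0) (intro mult_mono, auto)
    also have "\<dots> \<le> 45 / 100"
    proof -
      have "t^2 > 50^2" using assms by (intro power_strict_mono) auto
      then show ?thesis using assms by (simp add: field_simps power2_eq_square)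
    qed
    finally show ?thesis .
  qed
  finally have tail: "cmod (\<Sum>n. mid_err s (real (n + N) + b)) \<le> 45 / 100" .

  have "cmod (of_real (real N + b - 1/2) powr (1 - s) / (s - 1)) = 1 / t"
  proof -
    have "cmod (of_real (real N + b - 1/2) powr (1 - s)) = 1"
      using assms s by (subst norm_of_real_powr) auto
    moreover have "cmod (s - 1) = t"
      using assms by (simp add: s_def norm_mult)
    ultimately show ?thesis by (simp add: norm_divide)
  qed
  also have "\<dots> \<le> 2 / 100"
    using assms by (simp add: field_simps)
  finally have boundary: "cmod (of_real (real N + b - 1/2) powr (1 - s) / (s - 1)) \<le> 2 / 100" .

  have "cmod (hurwitz b s) \<le> harm N + 45 / 100 + 2 / 100"
    unfolding hurwitz_shift[OF assms(1) s(2,3), of N]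
    by (intro norm_triangle_le add_mono head tail boundary)
  moreover have "harm N < ln (real N + 1) + euler_mascheroni"
    by (rule harm_less_ln_add_euler_mascheroni)
  \<comment> \<open>\<open>t/4 + 1 < 27/100 * t\<close> for \<open>t > 50\<close>. Splitting
    \<open>27/100\<close> as \<open>1/3 * 81/100\<close> gives a logarithm of at most
    \<open>ln t - 1 - 19/100\<close>, which outweighs \<open>13/22 + 47/100\<close>.\<close>
  moreover have "ln (real N + 1) \<le> ln (t * (1/3) * (81/100))"
    using N assms by (subst ln_le_cancel_iff) auto
  moreover have "ln (t * (1/3) * (81/100)) = ln t - ln 3 + ln (81/100)"
    using assms ln_mult_pos[of "t * (1/3)" "81/100"] ln_mult_pos[of t "1/3"] ln_div[of 1 3] by simp
  moreover have "ln (81/100 :: real) \<le> 81/100 - 1"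
    by (rule ln_le_minus_one) simp
  moreover have "ln (3::real) \<ge> 1"
    using exp_le by (subst ln_ge_iff) auto
  ultimately have "cmod (hurwitz b s) < ln t"
    using euler_mascheroni_less_13_over_22 by linarith
  then show ?thesis
    by (simp add: s_def)
qed

section \<open>Uniqueness of the continuation of the Dirichlet series\<close>

text \<open>Any competing continuation agrees with \<open>F\<close> for \<open>Re z > 1\<close>. The
  identity theorem extends this to the smaller of the two half-planes without the point 1, which is
  still connected.\<close>

lemma dirichlet_L_eqI:
  assumes "c \<le> 1" "c < Re s" "s \<noteq> 1" and F: "F holomorphic_on {z. Re z > c} - {1}"
    and F_sums: "\<And>z. Re z > 1 \<Longrightarrow> (\<lambda>n. chi (int (Suc n)) * of_nat (Suc n) powr - z) sums F z"
  shows "dirichlet_L s chi = F s"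
  unfolding dirichlet_L_def
proof (rule the_equality)
  show "\<exists>c f P. c \<le> 1 \<and> c < Re s \<and> P \<subseteq> {1} \<and> s \<notin> P \<and> f holomorphic_on {z. c < Re z} - P \<and>
      (\<forall>z. 1 < Re z \<longrightarrow> (\<lambda>n. chi (int (Suc n)) * of_nat (Suc n) powr - z) sums f z) \<and> F s = f s"
    using assms by (intro exI[of _ c] exI[of _ F] exI[of _ "{1}"]) auto
next
  fix w
  assume "\<exists>c f P. c \<le> 1 \<and> c < Re s \<and> P \<subseteq> {1} \<and> s \<notin> P \<and> f holomorphic_on {z. c < Re z} - P \<and>
      (\<forall>z. 1 < Re z \<longrightarrow> (\<lambda>n. chi (int (Suc n)) * of_nat (Suc n) powr - z) sums f z) \<and> w = f s"
  then obtain d f P where d: "d \<le> 1" "d < Re s" and P: "P \<subseteq> {1}"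
    and f: "f holomorphic_on {z. d < Re z} - P" and ws: "w = f s"
    and f_sums: "\<And>z. 1 < Re z \<Longrightarrow> (\<lambda>n. chi (int (Suc n)) * of_nat (Suc n) powr - z) sums f z"
    by blast
  let ?S = "{z. max c d < Re z} - {1}"
  have "f s = F s"
  proof (rule analytic_continuation_open[of "{z. 1 < Re z}" ?S f F])
    show "open {z. 1 < Re z}"
      by (rule open_halfspace_Re_gt)
    show "open ?S"
      by (intro open_Diff open_halfspace_Re_gt) auto
    show "{z. 1 < Re z} \<noteq> {}"
      by (auto intro!: exI[of _ 2])
    show "connected ?S"
      by (intro connected_open_delete open_halfspace_Re_gt convex_connected convex_halfspace_Re_gt) auto
    show "{z. 1 < Re z} \<subseteq> ?S"
      using assms d by auto
    show "f holomorphic_on ?S"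
      using P by (intro holomorphic_on_subset[OF f]) auto
    show "F holomorphic_on ?S"
      by (intro holomorphic_on_subset[OF F]) auto
    show "f z = F z" if "z \<in> {z. 1 < Re z}" for z
      using that f_sums[of z] F_sums[of z] sums_unique2 by auto
    show "s \<in> ?S"
      using assms d by auto
  qed
  with ws show "w = F s" by simp
qed

section \<open>Values of Dirichlet characters\<close>

context
  fixes q :: nat and chi :: "int \<Rightarrow> complex"
  assumes chi: "dirichlet_character q chi"
begin

lemma dirichlet_character_mult: "chi (m * n) = chi m * chi n"
  and dirichlet_character_nonzero_iff: "chi n \<noteq> 0 \<longleftrightarrow> coprime n (int q)"
  and dirichlet_character_modulus_pos: "q > 0"
  using chi unfolding dirichlet_character_def by blast+

lemma dirichlet_character_add_mult: "chi (n + int k * int q) = chi n"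
proof (induction k)
  case (Suc k)
  have "chi (n + int (Suc k) * int q) = chi (n + int k * int q + int q)"
    by (simp add: algebra_simps)
  with Suc show ?case
    using chi by (simp only: dirichlet_character_def)
qed simp

lemma dirichlet_character_one: "chi 1 = 1"
  using dirichlet_character_mult[of 1 1] dirichlet_character_nonzero_iff[of 1] by simp

lemma dirichlet_character_power: "chi (m ^ k) = chi m ^ k"
  by (induction k) (simp_all add: dirichlet_character_one dirichlet_character_mult)

text \<open>By Euler's theorem and periodicity, a nonzero value is a root of unity.\<close>

lemma norm_dirichlet_character:
  "cmod (chi (int n)) = (if coprime n q then 1 else 0)"
proof (cases "coprime n q")
  case True
  then have "[n ^ totient q = 1] (mod q)"
    by (rule euler_theorem)
  then have "n ^ totient q mod q = 1 mod q"
    by (simp add: cong_def)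
  have "chi (int (x mod q)) = chi (int x)" for x
    using dirichlet_character_add_mult[of "int (x mod q)" "x div q"]
    by (simp flip: of_nat_mult of_nat_add)
  from this[of "n ^ totient q"] this[of 1] have "chi (int (n ^ totient q)) = chi (int 1)"
    using \<open>n ^ totient q mod q = 1 mod q\<close> by simp
  then have "chi (int n) ^ totient q = 1"
    by (simp add: dirichlet_character_power dirichlet_character_one)
  then have "cmod (chi (int n)) = 1"
    using power_eq_1_iff[of "chi (int n)" "totient q"] dirichlet_character_modulus_pos by simp
  with True show ?thesis by simp
next
  case False
  then show ?thesis
    using dirichlet_character_nonzero_iff[of "int n"] by simp
qed

lemma norm_dirichlet_character_le: "cmod (chi (int n)) \<le> 1"
  by (simp add: norm_dirichlet_character)

text \<open>Modulo 1 every integer is congruent to 1, so the only character is the principal one.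
  This is how non-principality enters the bound.\<close>

lemma dirichlet_character_modulus_gt_1:
  assumes "chi \<noteq> principal_character q"
  shows "q > 1"
proof (rule ccontr)
  assume "\<not> q > 1"
  with dirichlet_character_modulus_pos have q: "q = 1" by simp
  have "chi n = 1" for n
  \<comment> \<open>Only natural multiples of the period can be added: go up from 1 to
    \<open>n\<close>, or from \<open>n\<close> to 1.\<close>
  proof (cases "n \<ge> 1")
    case True
    then show ?thesis
      using dirichlet_character_add_mult[of 1 "nat (n - 1)"] q by (simp add: dirichlet_character_one)
  next
    case False
    then show ?thesis
      using dirichlet_character_add_mult[of n "nat (1 - n)"] q by (simp add: dirichlet_character_one)
  qed
  then have "chi = principal_character q"
    by (auto simp: principal_character_def q)
  with assms show False ..
qed

section \<open>Splitting the L-function into residue classes\<close>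

text \<open>Grouping the series into blocks of length \<open>q\<close> meets each residue once per
  block, and \<open>chi\<close> depends on the residue alone. The first term of each class stays
  outside, so that the Hurwitz parameter is at least 1, as the estimates require.\<close>

lemma dirichlet_series_sums:
  assumes "Re z > 1"
  shows "(\<lambda>n. chi (int (Suc n)) * of_nat (Suc n) powr - z) sums
    (\<Sum>a<q. chi (int (Suc a)) *
       (of_nat (Suc a) powr - z + of_nat q powr - z * hurwitz (1 + real (Suc a) / real q) z))"
proof -
  have q: "q > 0" by (rule dirichlet_character_modulus_pos)
  let ?f = "\<lambda>n. chi (int (Suc n)) * of_nat (Suc n) powr - z"
  have "summable (\<lambda>n. real (Suc n) powr - Re z)"
    using assms summable_real_powr_iff[of "- Re z"] summable_Suc_iff[of "\<lambda>n. real n powr - Re z"] by simp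
  then have "summable ?f"
  proof (rule summable_comparison_test'[of _ 0])
    fix n
    have "cmod (?f n) = cmod (chi (int (Suc n))) * real (Suc n) powr - Re z"
      using norm_of_real_powr[of "real (Suc n)" "- z"] by (simp add: norm_mult)
    then show "cmod (?f n) \<le> real (Suc n) powr - Re z"
      using norm_dirichlet_character_le[of "Suc n"] by (simp add: mult_left_le_one_le del: of_nat_Suc)
  qed
  then have "?f sums suminf ?f"
    by (rule summable_sums)
  then have "(\<lambda>m. sum ?f {m * q..<m * q + q}) sums suminf ?f"
    using q by (rule sums_group)
  moreover have "(\<lambda>m. sum ?f {m * q..<m * q + q}) sums
    (\<Sum>a<q. chi (int (Suc a)) *
       (of_nat (Suc a) powr - z + of_nat q powr - z * hurwitz (1 + real (Suc a) / real q) z))"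
  proof -
    have "sum ?f {m * q..<m * q + q} = (\<Sum>a<q. chi (int (Suc a)) * of_nat (m * q + Suc a) powr - z)" for m
    proof -
      have "sum ?f {m * q..<m * q + q} = (\<Sum>a<q. ?f (a + m * q))"
        using sum.shift_bounds_nat_ivl[of ?f 0 "m * q" q] by (simp add: add.commute lessThan_atLeast0)
      also have "\<dots> = (\<Sum>a<q. chi (int (Suc a)) * of_nat (m * q + Suc a) powr - z)"
      proof (rule sum.cong)
        fix a
        have *: "Suc (a + m * q) = m * q + Suc a" by simp
        have "chi (int (m * q + Suc a)) = chi (int (Suc a))"
          using dirichlet_character_add_mult[of "int (Suc a)" m] by (simp add: ac_simps)
        then show "?f (a + m * q) = chi (int (Suc a)) * of_nat (m * q + Suc a) powr - z"
          unfolding * by (simp only:)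
      qed simp
      finally show ?thesis .
    qed
    moreover have "(\<lambda>m. of_nat (m * q + Suc a) powr - z) sums
      (of_nat (Suc a) powr - z + of_nat q powr - z * hurwitz (1 + real (Suc a) / real q) z)" for a
    proof -
      define b where "b = 1 + real (Suc a) / real q"
      have b: "b \<ge> 1" by (simp add: b_def)
      have "of_nat (Suc m * q + Suc a) powr - z = of_nat q powr - z * of_real (real m + b) powr - z" for m
      proof -
        have "real (Suc m * q + Suc a) = real q * (real m + b)"
          using q by (simp add: b_def field_simps)
        then have "complex_of_nat (Suc m * q + Suc a) = of_nat q * of_real (real m + b)"
          by (metis of_real_mult of_real_of_nat_eq)
        also have "\<dots> powr - z = of_nat q powr - z * of_real (real m + b) powr - z"
          using b by (intro powr_times_real) auto
        finally show ?thesis .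
      qed
      moreover have "(\<lambda>m. of_nat q powr - z * of_real (real m + b) powr - z) sums
          (of_nat q powr - z * hurwitz b z)"
        using assms b by (intro sums_mult hurwitz_sums)
      ultimately have "(\<lambda>m. of_nat (Suc m * q + Suc a) powr - z) sums (of_nat q powr - z * hurwitz b z)"
        by (simp only:)
      then have "(\<lambda>m. of_nat (m * q + Suc a) powr - z) sums
          (of_nat q powr - z * hurwitz b z + of_nat (0 * q + Suc a) powr - z)"
        by (rule sums_Suc)
      then show ?thesis
        unfolding b_def by (simp only: mult_0 add_0 add.commute)
    qed
    then have "(\<lambda>m. \<Sum>a<q. chi (int (Suc a)) * of_nat (m * q + Suc a) powr - z) sums
      (\<Sum>a<q. chi (int (Suc a)) *
         (of_nat (Suc a) powr - z + of_nat q powr - z * hurwitz (1 + real (Suc a) / real q) z))"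
      by (intro sums_sum sums_mult)
    ultimately show ?thesis
      by (simp only:)
  qed
  ultimately have "suminf ?f = (\<Sum>a<q. chi (int (Suc a)) *
       (of_nat (Suc a) powr - z + of_nat q powr - z * hurwitz (1 + real (Suc a) / real q) z))"
    by (rule sums_unique2)
  with \<open>?f sums suminf ?f\<close> show ?thesis
    by (simp only:)
qed

lemma dirichlet_L_eq_sum_hurwitz:
  assumes "Re s > 0" "s \<noteq> 1"
  shows "dirichlet_L s chi = (\<Sum>a<q. chi (int (Suc a)) *
       (of_nat (Suc a) powr - s + of_nat q powr - s * hurwitz (1 + real (Suc a) / real q) s))"
proof (rule dirichlet_L_eqI[where c = 0])
  show "(\<lambda>z. \<Sum>a<q. chi (int (Suc a)) *
       (of_nat (Suc a) powr - z + of_nat q powr - z * hurwitz (1 + real (Suc a) / real q) z))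
     holomorphic_on {z. Re z > 0} - {1}"
    by (intro holomorphic_on_sum holomorphic_on_mult holomorphic_on_add holomorphic_on_const
        holomorphic_on_powr_right holomorphic_on_minus holomorphic_on_ident holomorphic_on_hurwitz) simp
qed (use assms in \<open>simp_all only: dirichlet_series_sums zero_le_one not_False_eq_True\<close>)

end

theorem theorem1:
  fixes q :: nat and chi :: "int \<Rightarrow> complex" and t :: real
  assumes "q \<ge> 1"
    and "dirichlet_character q chi"
    and "chi \<noteq> principal_character q"
    and "t > 50"
  shows "cmod (dirichlet_L (1 + \<i> * of_real t) chi) <
           real (totient q) / real q * ln t + ln (real q) + euler_mascheroni"
proof -
  note chi = assms(2) and t = assms(4)
  define s where "s = 1 + \<i> * of_real t"
  have q: "q > 1" by (rule dirichlet_character_modulus_gt_1[OF chi assms(3)])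
  \<comment> \<open>\<open>a\<close> stands for the residue \<open>a + 1\<close>, so
    \<open>A\<close> is a shifted copy of the totatives of \<open>q\<close>.\<close>
  define A where "A = {a. a < q \<and> coprime (Suc a) q}"
  \<comment> \<open>For q > 1 the residue q itself is not coprime to q. Dropping it is what replaces
    harm q, which exceeds ln q + gamma, by harm (q - 1).\<close>
  have A: "finite A" "A \<subseteq> {..<q - 1}"
  proof -
    show "A \<subseteq> {..<q - 1}"
    proof
      fix a assume a: "a \<in> A"
      moreover have "Suc a \<noteq> q"
        using a q by (auto simp: A_def)
      ultimately show "a \<in> {..<q - 1}"
        by (auto simp: A_def)
    qed
    then show "finite A" by (rule finite_subset) simp
  qed
  have "bij_betw Suc A (totatives q)"
    by (rule bij_betwI[of _ _ _ "\<lambda>a. a - 1"])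
       (auto simp: A_def totatives_def intro: Suc_lessI)
  then have card_A: "card A = totient q"
    unfolding totient_def by (rule bij_betw_same_card)
  have norm_powr: "cmod (of_nat n powr - s) = inverse (real n)" if "n > 0" for n
    using norm_of_real_powr[of "real n" "- s"] that by (simp add: s_def powr_minus)
  have "cmod (dirichlet_L s chi) \<le> (\<Sum>a<q. cmod (chi (int (Suc a)) *
       (of_nat (Suc a) powr - s + of_nat q powr - s * hurwitz (1 + real (Suc a) / real q) s)))"
    using t by (subst dirichlet_L_eq_sum_hurwitz[OF chi]) (auto simp: s_def intro: norm_sum)
  also have "\<dots> \<le> (\<Sum>a<q. if coprime (Suc a) q then inverse (real (Suc a)) + inverse (real q) * ln t else 0)"
  proof (rule sum_mono)
    fix a
    let ?v = "of_nat (Suc a) powr - s + of_nat q powr - s * hurwitz (1 + real (Suc a) / real q) s"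
    have "cmod ?v \<le> cmod (of_nat (Suc a) powr - s) +
        cmod (of_nat q powr - s) * cmod (hurwitz (1 + real (Suc a) / real q) s)"
      by (intro norm_triangle_le) (simp add: norm_mult)
    also have "\<dots> \<le> inverse (real (Suc a)) + inverse (real q) * ln t"
    proof (intro add_mono mult_mono)
      show "cmod (hurwitz (1 + real (Suc a) / real q) s) \<le> ln t"
        unfolding s_def using t by (intro less_imp_le[OF norm_hurwitz_one_line_less]) auto
    qed (use q norm_powr in \<open>simp_all del: of_nat_Suc\<close>)
    finally show "cmod (chi (int (Suc a)) * ?v) \<le>
        (if coprime (Suc a) q then inverse (real (Suc a)) + inverse (real q) * ln t else 0)"
      unfolding norm_mult norm_dirichlet_character[OF chi] by simp
  qed
  also have "\<dots> = (\<Sum>a\<in>A. inverse (real (Suc a)) + inverse (real q) * ln t)"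
    by (simp add: A_def sum.If_cases Int_def del: of_nat_Suc)
  also have "\<dots> = (\<Sum>a\<in>A. inverse (real (Suc a))) + real (totient q) / real q * ln t"
    by (simp add: sum.distrib card_A divide_inverse del: of_nat_Suc)
  finally have "cmod (dirichlet_L s chi) \<le>
      (\<Sum>a\<in>A. inverse (real (Suc a))) + real (totient q) / real q * ln t" .
  moreover have "(\<Sum>a\<in>A. inverse (real (Suc a))) \<le> harm (q - 1)"
    unfolding harm_altdef using A(2) by (intro sum_mono2) auto
  \<comment> \<open>The strictness of the final inequality comes from here.\<close>
  moreover have "harm (q - 1) < ln (real (q - 1) + 1) + euler_mascheroni"
    by (rule harm_less_ln_add_euler_mascheroni)
  moreover have "real (q - 1) + 1 = real q"
    using q by simp
  ultimately show ?thesis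
    unfolding s_def by simp
qed

end
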